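(* Let $\varepsilon > 0$. There is a constant $C = C(\varepsilon)$ such that for all sufficiently large $n$ there is an $n$-vertex graph containing no subgraph isomorphic to $K_{3,3}$ which is $k$-regular, where \[ k \geq (n/13)^{2/3} - C n^{3/5+\varepsilon} \text{ if } n \text{ is odd}, \qquad k \geq (n/14)^{2/3} - C n^{3/5+\varepsilon} \text{ if } n \text{ is even}. \]
   Context: Graphs are finite and simple; $K_{3,3}$ is the complete bipartite graph with both parts of size $3$. *)

theory Defs
  imports Complex_Main "Graph_Theory.Graph_Theory"
begin

text \<open>
  Finite simple graphs are represented as finite symmetric loopfree digraphs
  (\<^locale>\<open>graph\<close>, \<^locale>\<open>pair_graph\<close>): an edge \<open>{u,v}\<close> is the pair of arcs
  \<open>(u,v)\<close>, \<open>(v,u)\<close>. Hence \<^const>\<open>out_degree\<close> is the usual vertex degree.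
\<close>

definition regular_graph :: "nat \<Rightarrow> ('a,'b) pre_digraph \<Rightarrow> bool" where
  "regular_graph k G \<longleftrightarrow> graph G \<and> (\<forall>v\<in>verts G. out_degree G v = k)"

text \<open>
  \<^term>\<open>K\<^bsub>3,3\<^esub>\<close> is an isomorphism-invariant predicate, so this excludes every subgraph
  (induced or not) isomorphic to the complete bipartite graph.
\<close>

definition K33_free :: "('a,'b) pre_digraph \<Rightarrow> bool" where
  "K33_free G \<longleftrightarrow> \<not> (\<exists>H. subgraph H G \<and> K\<^bsub>3,3\<^esub> H)"

end

theory Submission
  imports Defs "HOL-Number_Theory.Number_Theory" "HOL-Real_Asymp.Real_Asymp"
begin

text \<open>
  Let \<open>p\<close> be an odd prime and \<open>g\<close> a nonresidue. The quadric \<open>u v = g y\<^sup>2 - 1\<close> over the field with \<open>p\<close>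
  elements is symmetric about the origin and contains no line (on a line \<open>u\<close> or \<open>v\<close> would
  vanish somewhere), so, as for Brown's spheres, three distinct translates of it share at most two points.
  Instead of combining many prime cubes to reach a given \<open>n\<close>, a box of points of this quadric is
  mapped by a Freiman isomorphism of order two into the integers modulo \<open>n\<close>, where it generates a
  circulant graph. A box with sides \<open>p, p, L\<close> fits if \<open>n\<close> is about \<open>8 p\<^sup>2 L\<close>, and then the degree is
  exactly \<open>(p - 1) L\<close>. With \<open>x\<^sup>3 = n / 13\<close> this is at least \<open>x\<^sup>2\<close> for every prime \<open>p\<close> between
  \<open>1.01 x\<close> and \<open>1.6 x\<close>, since \<open>13 / 8 > 1.6\<close>; such a prime exists by Chebyshev's method. Hence even
  \<open>C = 0\<close> works.
\<close>

section \<open>Quadrics without lines\<close>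

text \<open>Vectors over the field with \<open>p\<close> elements are kept as integer triples, so
  that the same triples can later be embedded into the integers.\<close>

definition zero_mod :: "int \<Rightarrow> int \<times> int \<times> int \<Rightarrow> bool" where
  "zero_mod p w \<longleftrightarrow> (case w of (a, b, c) \<Rightarrow> p dvd a \<and> p dvd b \<and> p dvd c)"

section \<open>Linear algebra modulo a prime in dimension three\<close>

lemma prime_inverse_mod:
  fixes p a :: int
  assumes "prime p" "\<not> p dvd a"
  obtains b where "p dvd a * b - 1"
proof -
  have "coprime a p"
    using assms by (metis coprime_commute prime_imp_coprime)
  then obtain b where "[a * b = 1] (mod p)"
    using cong_solve_coprime_int by blast
  then show ?thesis
    using that by (auto simp: cong_iff_dvd_diff)
qed

text \<open>Take \<open>t\<close> to be \<open>a'\<close> divided by \<open>a\<close> modulo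
  \<open>p\<close>; the two vanishing minors that involve \<open>a\<close> then fix the other
  coordinates after cancelling \<open>a\<close>.\<close>

lemma parallel_mod_aux:
  fixes p :: int
  assumes p: "prime p" and nz: "\<not> p dvd a"
    and "p dvd a * b' - a' * b" "p dvd a * c' - a' * c"
  obtains t where "p dvd a' - t * a" "p dvd b' - t * b" "p dvd c' - t * c"
proof -
  obtain r where r: "p dvd a * r - 1" using prime_inverse_mod[OF p nz] by blast
  define t where "t = a' * r"
  have "a' - t * a = - a' * (a * r - 1)" by (simp add: t_def algebra_simps)
  then have 1: "p dvd a' - t * a" using r by (metis dvd_mult)
  have "a * (b' - t * b) = (a * b' - a' * b) + b * (a' - t * a)" by (simp add: algebra_simps)
  then have "p dvd a * (b' - t * b)" using assms 1 by (metis dvd_add dvd_mult)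
  then have 2: "p dvd b' - t * b" using p nz prime_dvd_mult_iff by blast
  have "a * (c' - t * c) = (a * c' - a' * c) + c * (a' - t * a)" by (simp add: algebra_simps)
  then have "p dvd a * (c' - t * c)" using assms 1 by (metis dvd_add dvd_mult)
  then have 3: "p dvd c' - t * c" using p nz prime_dvd_mult_iff by blast
  show ?thesis using that 1 2 3 by blast
qed

definition cross :: "int \<times> int \<times> int \<Rightarrow> int \<times> int \<times> int \<Rightarrow> int \<times> int \<times> int" where
  "cross = (\<lambda>(a, b, c) (a', b', c'). (b * c' - b' * c, c * a' - c' * a, a * b' - a' * b))"

lemma parallel_mod:
  fixes p :: int
  assumes p: "prime p" and nz: "\<not> zero_mod p (a, b, c)"
    and cr: "zero_mod p (cross (a, b, c) (a', b', c'))"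
  obtains t where "p dvd a' - t * a" "p dvd b' - t * b" "p dvd c' - t * c"
proof -
  have c1: "p dvd b * c' - b' * c" "p dvd c * b' - c' * b"
    and c2: "p dvd c * a' - c' * a" "p dvd a * c' - a' * c"
    and c3: "p dvd a * b' - a' * b" "p dvd b * a' - b' * a"
    using cr dvd_minus_iff[of p "b * c' - b' * c"] dvd_minus_iff[of p "c * a' - c' * a"]
      dvd_minus_iff[of p "a * b' - a' * b"]
    by (auto simp: cross_def zero_mod_def mult.commute)
  consider "\<not> p dvd a" | "\<not> p dvd b" | "\<not> p dvd c"
    using nz by (auto simp: zero_mod_def)
  then show ?thesis
  proof cases
    case 1 then show ?thesis using parallel_mod_aux[OF p 1 c3(1) c2(2)] that by metis
  next
    case 2 then show ?thesis using parallel_mod_aux[OF p 2 c3(2) c1(1)] that by metis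
  next
    case 3 then show ?thesis using parallel_mod_aux[OF p 3 c2(1) c1(2)] that by metis
  qed
qed

text \<open>The vectors orthogonal to an independent pair form a line, spanned by the cross product
  of the pair, so any two of them are dependent.\<close>

lemma cross_orthogonal_mod:
  fixes p :: int
  assumes p: "prime p"
    and "p dvd a * x + b * y + c * z" "p dvd a' * x + b' * y + c' * z"
    and "p dvd a * x' + b * y' + c * z'" "p dvd a' * x' + b' * y' + c' * z'"
    and nz: "\<not> zero_mod p (cross (a, b, c) (a', b', c'))"
  shows "zero_mod p (cross (x, y, z) (x', y', z'))"
proof -
  define n1 n2 n3 where n: "n1 = b * c' - b' * c" "n2 = c * a' - c' * a" "n3 = a * b' - a' * b"
  have par: "p dvd y * n3 - z * n2" "p dvd z * n1 - x * n3" "p dvd x * n2 - y * n1"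
    if "p dvd a * x + b * y + c * z" "p dvd a' * x + b' * y + c' * z" for x y z
  proof -
    have "y * n3 - z * n2 = a * (a' * x + b' * y + c' * z) - a' * (a * x + b * y + c * z)"
      "z * n1 - x * n3 = b * (a' * x + b' * y + c' * z) - b' * (a * x + b * y + c * z)"
      "x * n2 - y * n1 = c * (a' * x + b' * y + c' * z) - c' * (a * x + b * y + c * z)"
      by (simp_all add: n algebra_simps)
    then show "p dvd y * n3 - z * n2" "p dvd z * n1 - x * n3" "p dvd x * n2 - y * n1"
      using that by (metis dvd_diff dvd_mult)+
  qed
  note P = par[OF assms(2,3)] and P' = par[OF assms(4,5)]
  have nz': "\<not> p dvd n1 \<or> \<not> p dvd n2 \<or> \<not> p dvd n3"
    using nz by (auto simp: n cross_def zero_mod_def)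
  have *: "p dvd y * z' - y' * z"
  proof -
    \<comment> \<open>It is unknown which component of the normal is invertible, so the coordinate
      is multiplied by each of the three and becomes a combination of the congruences
      \<open>P\<close> and \<open>P'\<close>.\<close>
    have e1: "n1 * (y * z' - y' * z) =
        y * (z' * n1 - x' * n3) - z * (y' * n1 - x' * n2) + x' * (y * n3 - z * n2)"
      by (simp add: algebra_simps)
    have e2: "n2 * (y * z' - y' * z) = y * (z' * n2 - y' * n3) + y' * (y * n3 - z * n2)"
      by (simp add: algebra_simps)
    have e3: "n3 * (y * z' - y' * z) = z' * (y * n3 - z * n2) - z * (y' * n3 - z' * n2)"
      by (simp add: algebra_simps)
    have "p dvd y' * n1 - x' * n2" "p dvd z' * n2 - y' * n3"
      using P' by (metis dvd_minus_iff minus_diff_eq)+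
    then have "p dvd n1 * (y * z' - y' * z)" "p dvd n2 * (y * z' - y' * z)" "p dvd n3 * (y * z' - y' * z)"
      unfolding e1 e2 e3 using P P' by (metis dvd_diff dvd_add dvd_mult)+
    then show ?thesis using nz' p prime_dvd_mult_iff by blast
  qed
  have **: "p dvd z * x' - z' * x"
  proof -
    have e1: "n1 * (z * x' - z' * x) = x' * (z * n1 - x * n3) - x * (z' * n1 - x' * n3)"
      by (simp add: algebra_simps)
    have e2: "n2 * (z * x' - z' * x) =
        z * (x' * n2 - y' * n1) + x * (y' * n3 - z' * n2) + y' * (z * n1 - x * n3)"
      by (simp add: algebra_simps)
    have e3: "n3 * (z * x' - z' * x) = z' * (z * n1 - x * n3) - z * (z' * n1 - x' * n3)"
      by (simp add: algebra_simps)
    have "p dvd n1 * (z * x' - z' * x)" "p dvd n2 * (z * x' - z' * x)" "p dvd n3 * (z * x' - z' * x)"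
      unfolding e1 e2 e3 using P P' by (metis dvd_diff dvd_add dvd_mult)+
    then show ?thesis using nz' p prime_dvd_mult_iff by blast
  qed
  have ***: "p dvd x * y' - x' * y"
  proof -
    have e1: "n1 * (x * y' - x' * y) = x' * (x * n2 - y * n1) - x * (x' * n2 - y' * n1)"
      by (simp add: algebra_simps)
    have e2: "n2 * (x * y' - x' * y) = y' * (x * n2 - y * n1) - y * (x' * n2 - y' * n1)"
      by (simp add: algebra_simps)
    have e3: "n3 * (x * y' - x' * y) =
        x * (y' * n3 - z' * n2) + y * (z' * n1 - x' * n3) + z' * (x * n2 - y * n1)"
      by (simp add: algebra_simps)
    have "p dvd n1 * (x * y' - x' * y)" "p dvd n2 * (x * y' - x' * y)" "p dvd n3 * (x * y' - x' * y)"
      unfolding e1 e2 e3 using P P' by (metis dvd_diff dvd_add dvd_mult)+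
    then show ?thesis using nz' p prime_dvd_mult_iff by blast
  qed
  from * ** *** show ?thesis by (simp add: cross_def zero_mod_def)
qed

text \<open>By \<open>no_root\<close> the inverse of \<open>g\<close>, hence \<open>g\<close>
  itself, is a nonresidue. An odd \<open>p\<close> and an invertible \<open>g\<close> make the polar
  form nondegenerate.\<close>

locale elliptic_quadric =
  fixes p g :: int
  assumes prime_p: "prime p" and odd_p: "odd p" and g_nz: "\<not> p dvd g"
    and no_root: "\<not> p dvd g * y\<^sup>2 - 1"
begin

definition on_quadric :: "int \<Rightarrow> int \<Rightarrow> int \<Rightarrow> bool" where
  "on_quadric u v y \<longleftrightarrow> p dvd u * v - g * y\<^sup>2 + 1"

text \<open>On the line through \<open>(x, y, z)\<close> in direction \<open>(a, b, c)\<close> the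
  equation is quadratic in the parameter \<open>s\<close>. The last two assumptions kill its
  coefficients, so the whole line lies on the quadric. If \<open>a\<close> were invertible, some
  \<open>s\<close> would make the first coordinate vanish, and \<open>g\<close> times a square would
  be 1.\<close>

lemma no_line_aux:
  assumes "on_quadric x y z" "p dvd a * b - g * c\<^sup>2" "p dvd a * y + b * x - 2 * g * c * z"
  shows "p dvd a"
proof (rule ccontr)
  assume "\<not> p dvd a"
  then obtain r where r: "p dvd a * r - 1" using prime_inverse_mod[OF prime_p] by blast
  define s where "s = - x * r"
  have "x + s * a = - x * (a * r - 1)" by (simp add: s_def algebra_simps)
  then have 1: "p dvd x + s * a" using r by (metis dvd_mult)
  have "g * (z + s * c)\<^sup>2 - 1 = (y + s * b) * (x + s * a) - (x * y - g * z\<^sup>2 + 1)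
     - s\<^sup>2 * (a * b - g * c\<^sup>2) - s * (a * y + b * x - 2 * g * c * z)"
    by (simp add: algebra_simps power2_eq_square)
  also have "p dvd \<dots>"
    using assms 1 by (auto simp: on_quadric_def intro!: dvd_diff dvd_mult)
  finally show False using no_root by blast
qed

lemma no_line:
  assumes "on_quadric x y z" "p dvd a * b - g * c\<^sup>2" "p dvd a * y + b * x - 2 * g * c * z"
  shows "zero_mod p (a, b, c)"
proof -
  have 1: "p dvd a" by (rule no_line_aux[OF assms])
  \<comment> \<open>The equation is symmetric in its first two coordinates.\<close>
  have 2: "p dvd b"
    by (rule no_line_aux[of y x z _ a c])
      (use assms in \<open>auto simp: on_quadric_def mult.commute add.commute\<close>)
  have "g * c\<^sup>2 = b * a - (a * b - g * c\<^sup>2)" by simp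
  also have "p dvd \<dots>" using dvd_diff[OF dvd_mult[OF 1] assms(2)] .
  finally have "p dvd c"
    using prime_p g_nz by (metis prime_dvd_mult_iff prime_dvd_power)
  with 1 2 show ?thesis by (simp add: zero_mod_def)
qed

text \<open>If the three points were collinear, the quadratic along their line would have the
  distinct roots 0, 1 and \<open>t\<close>, so it would vanish identically, against
  \<open>no_line\<close>.\<close>

lemma three_on_line:
  assumes "on_quadric x y z" "on_quadric (x + a) (y + b) (z + c)"
    and "on_quadric (x + a') (y + b') (z + c')"
    and nz: "\<not> zero_mod p (a, b, c)" "\<not> zero_mod p (a', b', c')"
      "\<not> zero_mod p (a' - a, b' - b, c' - c)"
  shows "\<not> zero_mod p (cross (a, b, c) (a', b', c'))"
proof
  assume "zero_mod p (cross (a, b, c) (a', b', c'))"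
  then obtain t where t: "p dvd a' - t * a" "p dvd b' - t * b" "p dvd c' - t * c"
    using parallel_mod[OF prime_p nz(1)] by blast
  define q where "q = a * b - g * c\<^sup>2"
  define l where "l = a * y + b * x - 2 * g * c * z"
  have 1: "p dvd q + l"
  proof -
    have "q + l = ((x + a) * (y + b) - g * (z + c)\<^sup>2 + 1) - (x * y - g * z\<^sup>2 + 1)"
      by (simp add: q_def l_def algebra_simps power2_eq_square)
    then show ?thesis using assms by (metis dvd_diff on_quadric_def)
  qed
  have 2: "p dvd t\<^sup>2 * q + t * l"
  proof -
    have "t\<^sup>2 * q + t * l = ((x + a') * (y + b') - g * (z + c')\<^sup>2 + 1) - (x * y - g * z\<^sup>2 + 1)
       - (y + t * b) * (a' - t * a) - (x + a') * (b' - t * b)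
       + g * (2 * z + t * c + c') * (c' - t * c)"
      by (simp add: q_def l_def algebra_simps power2_eq_square)
    also have "p dvd \<dots>"
      using dvd_add[OF dvd_diff[OF dvd_diff[OF dvd_diff[OF assms(3,1)[unfolded on_quadric_def]]
        dvd_mult[OF t(1)]] dvd_mult[OF t(2)]] dvd_mult[OF t(3)]] .
    finally show ?thesis .
  qed
  \<comment> \<open>Eliminating the linear coefficient \<open>l\<close> from the values at 1 and
    \<open>t\<close> leaves \<open>t * (t - 1) * q\<close>.\<close>
  have "p dvd (t\<^sup>2 * q + t * l) - t * (q + l)" using 1 2 by (intro dvd_diff dvd_mult)
  also have "(t\<^sup>2 * q + t * l) - t * (q + l) = t * ((t - 1) * q)"
    by (simp add: algebra_simps power2_eq_square)
  finally have "p dvd t \<or> p dvd t - 1 \<or> p dvd q"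
    using prime_p by (simp add: prime_dvd_mult_iff)
  moreover have "\<not> p dvd t"
  proof
    assume "p dvd t"
    then have "p dvd (a' - t * a) + t * a" "p dvd (b' - t * b) + t * b" "p dvd (c' - t * c) + t * c"
      using t by (meson dvd_add dvd_mult2)+
    then show False using nz(2) by (simp add: zero_mod_def)
  qed
  moreover have "\<not> p dvd t - 1"
  proof
    assume "p dvd t - 1"
    then have "p dvd (a' - t * a) + (t - 1) * a" "p dvd (b' - t * b) + (t - 1) * b"
      "p dvd (c' - t * c) + (t - 1) * c"
      using t by (meson dvd_add dvd_mult2)+
    then show False using nz(3) by (simp add: zero_mod_def algebra_simps)
  qed
  ultimately have q: "p dvd q" by blast
  then have "p dvd l" using 1 by (simp add: dvd_add_right_iff)
  then show False using no_line[OF assms(1)] q nz(1) by (simp add: q_def l_def)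
qed

text \<open>The alternating sum of a quadratic polynomial over a parallelogram is its polar form at
  the two sides, written here as a dot product with \<open>(b', a', - 2 * g * c')\<close>.\<close>

lemma polar:
  assumes "on_quadric x y z" "on_quadric (x + a) (y + b) (z + c)" "on_quadric (x + a') (y + b') (z + c')"
    and "on_quadric (x + a + a') (y + b + b') (z + c + c')"
  shows "p dvd a * b' + b * a' + c * (- 2 * g * c')"
proof -
  have "a * b' + b * a' + c * (- 2 * g * c')
     = ((x + a + a') * (y + b + b') - g * (z + c + c')\<^sup>2 + 1) + (x * y - g * z\<^sup>2 + 1)
     - ((x + a) * (y + b) - g * (z + c)\<^sup>2 + 1) - ((x + a') * (y + b') - g * (z + c')\<^sup>2 + 1)"
    by (simp add: algebra_simps power2_eq_square)
  then show ?thesis using assms by (simp only: on_quadric_def dvd_diff dvd_add)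
qed

text \<open>Both direction pairs are independent by \<open>three_on_line\<close>, yet orthogonal for the polar form,
  which is impossible in dimension three.\<close>

lemma no_grid:
  assumes on: "on_quadric x y z"
    "on_quadric (x + a) (y + b) (z + c)" "on_quadric (x + a') (y + b') (z + c')"
    "on_quadric (x + d) (y + e) (z + f)" "on_quadric (x + d') (y + e') (z + f')"
    "on_quadric (x + a + d) (y + b + e) (z + c + f)"
    "on_quadric (x + a + d') (y + b + e') (z + c + f')"
    "on_quadric (x + a' + d) (y + b' + e) (z + c' + f)"
    "on_quadric (x + a' + d') (y + b' + e') (z + c' + f')"
    and nz: "\<not> zero_mod p (a, b, c)" "\<not> zero_mod p (a', b', c')"
      "\<not> zero_mod p (a' - a, b' - b, c' - c)"
      "\<not> zero_mod p (d, e, f)" "\<not> zero_mod p (d', e', f')"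
      "\<not> zero_mod p (d' - d, e' - e, f' - f)"
  shows False
proof -
  \<comment> \<open>These are the images of the second pair under the matrix of the polar form; by
    \<open>polar\<close> both are orthogonal to the first pair.\<close>
  have "zero_mod p (cross (e, d, - 2 * g * f) (e', d', - 2 * g * f'))"
  proof (rule cross_orthogonal_mod[OF prime_p])
    show "\<not> zero_mod p (cross (a, b, c) (a', b', c'))"
      using three_on_line on nz by blast
  qed (use polar on in blast)+
  then have *: "p dvd d * (- 2 * g * f') - d' * (- 2 * g * f)" "p dvd (- 2 * g * f) * e' - (- 2 * g * f') * e"
    "p dvd e * d' - e' * d" by (auto simp: zero_mod_def cross_def)
  \<comment> \<open>Since \<open>2 * g\<close> is invertible, the matrix of the polar form can be
    undone.\<close>
  have "\<not> p dvd 2" using prime_p odd_p by (metis even_numeral primes_dvd_imp_eq two_is_prime_nat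
    prime_int_numeral_eq)
  then have u: "\<not> p dvd 2 * g" using prime_p g_nz by (simp add: prime_dvd_mult_iff)
  have "d * (- 2 * g * f') - d' * (- 2 * g * f) = (2 * g) * (f * d' - f' * d)"
    "(- 2 * g * f) * e' - (- 2 * g * f') * e = (2 * g) * (e * f' - e' * f)"
    by (simp_all add: algebra_simps)
  with * u have "p dvd f * d' - f' * d" "p dvd e * f' - e' * f"
    using prime_p by (metis prime_dvd_mult_iff)+
  moreover have "p dvd d * e' - d' * e" using *(3) by (metis dvd_minus_iff minus_diff_eq mult.commute)
  ultimately have "zero_mod p (cross (d, e, f) (d', e', f'))"
    by (simp add: zero_mod_def cross_def)
  then show False using three_on_line on nz by blast
qed

end

text \<open>Squaring is not injective on residues, as 1 and -1 have the same square, so it misses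
  some \<open>c\<close>; the inverse of this \<open>c\<close> serves as \<open>g\<close>.\<close>

lemma exists_elliptic_quadric:
  assumes p: "prime (p::int)" "odd p"
  shows "\<exists>g. elliptic_quadric p g"
proof -
  have p2: "p > 2" using p by (metis order_le_less prime_ge_2_int even_numeral)
  define f where "f = (\<lambda>y. y\<^sup>2 mod p)"
  have "f 1 = f (p - 1)"
    by (simp add: f_def power2_eq_square algebra_simps mod_diff_eq[symmetric] mod_add_eq[symmetric])
  moreover have "1 \<in> {0..<p}" "p - 1 \<in> {0..<p}" "1 \<noteq> p - 1" using p2 by auto
  ultimately have "\<not> inj_on f {0..<p}" by (metis inj_onD)
  moreover have sub: "f ` {0..<p} \<subseteq> {0..<p}" using p2 by (auto simp: f_def)
  ultimately have "f ` {0..<p} \<noteq> {0..<p}"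
    using finite_surj_inj[of "{0..<p}" f] by auto
  then obtain c where c: "c \<in> {0..<p}" "c \<notin> f ` {0..<p}" using sub by blast
  have "f 0 = 0" by (simp add: f_def)
  then have "c \<noteq> 0" using c p2 by (metis atLeastLessThan_iff imageI order_refl order_less_trans zero_less_numeral)
  then have "\<not> p dvd c" using c by (auto simp: zdvd_not_zless)
  then obtain g where g: "p dvd c * g - 1" using prime_inverse_mod p by blast
  have "\<not> p dvd g"
  proof
    assume "p dvd g"
    then have "p dvd c * g - (c * g - 1)" using g by (meson dvd_diff dvd_mult)
    then show False using p2 by (simp add: zdvd_not_zless)
  qed
  moreover have "\<not> p dvd g * y\<^sup>2 - 1" for y
  proof
    assume "p dvd g * y\<^sup>2 - 1"
    then have "p dvd c * (g * y\<^sup>2 - 1) - y\<^sup>2 * (c * g - 1)" using g by (meson dvd_diff dvd_mult)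
    also have "c * (g * y\<^sup>2 - 1) - y\<^sup>2 * (c * g - 1) = y\<^sup>2 - c" by (simp add: algebra_simps)
    finally have "y\<^sup>2 mod p = c mod p" by (simp add: mod_eq_dvd_iff)
    then have "f (y mod p) = c" using c by (simp add: f_def power_mod)
    moreover have "y mod p \<in> {0..<p}" using p2 by simp
    ultimately show False using c by blast
  qed
  ultimately show ?thesis using p by (auto intro!: exI[of _ g] elliptic_quadric.intro)
qed

section \<open>Circulant graphs\<close>

definition circulant :: "nat \<Rightarrow> int set \<Rightarrow> nat pair_pre_digraph" where
  "circulant n D = \<lparr> pverts = {0..<n},
     parcs = {(a, b). a < n \<and> b < n \<and> (\<exists>d\<in>D. int n dvd int a - int b - d)} \<rparr>"

lemma circulant_pair_graph:
  assumes sym: "\<And>d. d \<in> D \<Longrightarrow> - d \<in> D" and nz: "\<And>d. d \<in> D \<Longrightarrow> \<not> int n dvd d"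
  shows "pair_graph (circulant n D)"
proof
  have "parcs (circulant n D) \<subseteq> {0..<n} \<times> {0..<n}" by (auto simp: circulant_def)
  then show "finite (parcs (circulant n D))" by (rule finite_subset) simp
  show "symmetric (with_proj (circulant n D))"
    unfolding symmetric_def
  proof (rule symI)
    fix a b assume "(a, b) \<in> arcs_ends (with_proj (circulant n D))"
    then obtain d where d: "a < n" "b < n" "d \<in> D" "int n dvd int a - int b - d"
      by (auto simp: circulant_def)
    have "int b - int a - (- d) = - (int a - int b - d)" by simp
    then have "int n dvd int b - int a - (- d)" using d by (metis dvd_minus_iff)
    then have "\<exists>d\<in>D. int n dvd int b - int a - d" using sym d(3) by blast
    then show "(b, a) \<in> arcs_ends (with_proj (circulant n D))"
      using d by (simp add: circulant_def)
  qed
qed (use nz in \<open>auto simp: circulant_def\<close>)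

lemma circulant_out_degree:
  assumes inj: "\<And>d d'. d \<in> D \<Longrightarrow> d' \<in> D \<Longrightarrow> int n dvd d - d' \<Longrightarrow> d = d'" and a: "a < n"
  shows "out_degree (with_proj (circulant n D)) a = card D"
proof -
  define f where "f d = (a, nat ((int a - d) mod int n))" for d
  have n: "int n > 0" using a by simp
  have "bij_betw f D (out_arcs (with_proj (circulant n D)) a)"
  proof (rule bij_betw_imageI)
    show "inj_on f D"
    proof (rule inj_onI)
      fix d d' assume d: "d \<in> D" "d' \<in> D" and "f d = f d'"
      then have "(int a - d) mod int n = (int a - d') mod int n"
        using n by (simp add: f_def nat_eq_iff)
      then have "int n dvd (int a - d) - (int a - d')" by (simp add: mod_eq_dvd_iff)
      then have "int n dvd d' - d" by simp
      then show "d = d'" using inj d by metis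
    qed
    show "f ` D = out_arcs (with_proj (circulant n D)) a"
    proof (intro equalityI subsetI)
      fix e assume "e \<in> f ` D"
      then obtain d where d: "d \<in> D" "e = f d" by blast
      have "int n dvd int a - (int a - d) mod int n - d"
        by (metis diff_diff_eq2 diff_add_eq diff_diff_add add.commute dvd_minus_mod diff_right_commute)
      then show "e \<in> out_arcs (with_proj (circulant n D)) a"
        using d n a by (auto simp: out_arcs_def circulant_def f_def nat_less_iff)
    next
      fix e assume "e \<in> out_arcs (with_proj (circulant n D)) a"
      then obtain b d where b: "e = (a, b)" "b < n" "d \<in> D" "int n dvd int a - int b - d"
        by (auto simp: out_arcs_def circulant_def)
      have "int n dvd (int a - d) - int b" using b by (simp add: algebra_simps)
      then have "(int a - d) mod int n = int b" using b by (simp add: mod_eq_dvd_iff[symmetric])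
      then have "e = f d" using b by (simp add: f_def)
      then show "e \<in> f ` D" using b by blast
    qed
  qed
  then show ?thesis by (simp add: out_degree_def bij_betw_same_card)
qed

text \<open>Enumerating the two colour classes turns a forbidden copy into a 3 by 3 array of
  elements of \<open>D\<close>, the form in which arithmetic applies.\<close>

lemma circulant_K33_free:
  assumes *: "\<And>a b. inj_on a {..<3::nat} \<Longrightarrow> inj_on b {..<3::nat} \<Longrightarrow> a ` {..<3} \<subseteq> {..<n} \<Longrightarrow> b ` {..<3} \<subseteq> {..<n}
     \<Longrightarrow> \<forall>i<3. \<forall>j<3. \<exists>d\<in>D. int n dvd int (a i) - int (b j) - d \<Longrightarrow> False"
  shows "K33_free (with_proj (circulant n D))"
  unfolding K33_free_def
proof
  assume "\<exists>H. subgraph H (with_proj (circulant n D)) \<and> K\<^bsub>3,3\<^esub> H"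
  then obtain H U V where H: "subgraph H (with_proj (circulant n D))"
    and UV: "card U = 3" "card V = 3" "arcs_ends H = U \<times> V \<union> V \<times> U"
    by (auto simp: complete_bipartite_digraph_def)
  have arc: "(u, v) \<in> parcs (circulant n D)" if "u \<in> U" "v \<in> V" for u v
  proof -
    have "(u, v) \<in> arcs_ends H" using that UV by blast
    moreover have "arcs_ends H \<subseteq> arcs_ends (with_proj (circulant n D))"
      using H unfolding arcs_ends_conv subgraph_def compatible_def by auto
    ultimately show ?thesis by auto
  qed
  have fin: "finite U" "finite V" using UV by (auto intro: card_ge_0_finite)
  obtain a b where ab: "bij_betw a {0..<card U} U" "bij_betw b {0..<card V} V"
    using ex_bij_betw_nat_finite fin by blast
  have arc': "(a i, b j) \<in> parcs (circulant n D)" if "i < 3" "j < 3" for i j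
    using that ab UV by (intro arc) (auto simp: bij_betw_def)
  show False
  proof (rule *)
    show "inj_on a {..<3}" "inj_on b {..<3}"
      using ab UV by (auto simp: bij_betw_def atLeast0LessThan)
    show "a ` {..<3} \<subseteq> {..<n}" "b ` {..<3} \<subseteq> {..<n}"
      using arc'[of _ 0] arc'[of 0] by (auto simp: circulant_def)
    show "\<forall>i<3. \<forall>j<3. \<exists>d\<in>D. int n dvd int (a i) - int (b j) - d"
      using arc' by (simp add: circulant_def)
  qed
qed

section \<open>Lifting congruences to integer identities by mixed radix expansions\<close>

lemma dvd_abs_less_imp_zero: "(q::int) dvd x \<Longrightarrow> \<bar>x\<bar> < q \<Longrightarrow> x = 0"
  by (metis dvd_imp_le_int abs_of_nonneg not_less order_less_imp_le abs_ge_zero order_trans)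

text \<open>The expansion is at most \<open>A * B\<^sup>2 - 1\<close> in absolute value, so
  divisibility by \<open>N\<close> makes it zero as an integer; the digits then vanish in turn,
  modulo \<open>A\<close> and modulo \<open>B\<close>.\<close>

lemma mixed_radix_zero:
  fixes A B N y u v :: int
  assumes "\<bar>y\<bar> < A" "\<bar>u\<bar> < B" "\<bar>v\<bar> < B" "A * B\<^sup>2 \<le> N" "N dvd y + A * u + A * B * v"
  shows "y = 0 \<and> u = 0 \<and> v = 0"
proof -
  have A: "A \<ge> 1" and B: "B \<ge> 1" using assms by linarith+
  have "\<bar>y + A * u + A * B * v\<bar> \<le> \<bar>y\<bar> + A * \<bar>u\<bar> + A * B * \<bar>v\<bar>"
    using A B by (simp add: abs_mult order_trans[OF abs_triangle_ineq])
  also have "\<dots> \<le> (A - 1) + A * (B - 1) + A * B * (B - 1)"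
    using A B assms by (intro add_mono mult_left_mono) auto
  also have "\<dots> = A * B\<^sup>2 - 1" by (simp add: algebra_simps power2_eq_square)
  also have "\<dots> < N" using assms by simp
  finally have 0: "y + A * (u + B * v) = 0"
    using dvd_abs_less_imp_zero assms by (simp add: algebra_simps)
  then have "y = A * (- (u + B * v))" by (simp add: algebra_simps)
  then have "A dvd y" by (rule dvdI)
  then have y: "y = 0" using dvd_abs_less_imp_zero assms by blast
  then have "u + B * v = 0" using 0 A by simp
  then have "u = B * (- v)" by simp
  then have "B dvd u" by (rule dvdI)
  then have "u = 0" using dvd_abs_less_imp_zero assms by blast
  then show ?thesis using y \<open>u + B * v = 0\<close> B by simp
qed

text \<open>With \<open>p = 2 * m + 1\<close>, the box \<open>[-m, m]\<^sup>2 \<times> [-h, h]\<close> of symmetric residues is mapped to the integers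
  modulo \<open>n\<close> by a mixed radix expansion whose radices leave room for sums of four points, so that
  \<open>s\<^sub>1 + s\<^sub>2 = s\<^sub>3 + s\<^sub>4\<close> holds for points if and only if it holds for their images.\<close>

locale lifted_quadric = elliptic_quadric +
  fixes m h :: int and n :: nat
  assumes p_eq: "p = 2 * m + 1" and h_nonneg: "0 \<le> h" and h_le: "h \<le> m"
    and n_ge: "(4 * h + 1) * (4 * m + 1)\<^sup>2 \<le> int n"
begin

definition points :: "(int \<times> int \<times> int) set" where
  "points = {(u, v, y). u \<in> {-m..m} \<and> v \<in> {-m..m} \<and> y \<in> {-h..h} \<and> on_quadric u v y}"

definition embed :: "int \<times> int \<times> int \<Rightarrow> int" where
  "embed = (\<lambda>(u, v, y). y + (4 * h + 1) * u + (4 * h + 1) * (4 * m + 1) * v)"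

lemma m_nonneg: "0 \<le> m" using h_nonneg h_le by simp

text \<open>The bounds \<open>4 * m\<close> and \<open>4 * h\<close> are those of signed sums of
  four points, which is what the 3 by 3 array produces.\<close>

lemma embed_zero:
  assumes "int n dvd embed (u, v, y)" "\<bar>u\<bar> \<le> 4 * m" "\<bar>v\<bar> \<le> 4 * m" "\<bar>y\<bar> \<le> 4 * h"
  shows "u = 0 \<and> v = 0 \<and> y = 0"
  using mixed_radix_zero[of y "4 * h + 1" u "4 * m + 1" v "int n"] assms n_ge
  by (simp add: embed_def)

lemma embed_inj:
  assumes "s \<in> points" "s' \<in> points" "int n dvd embed s - embed s'"
  shows "s = s'"
proof -
  obtain u v y u' v' y' where s: "s = (u, v, y)" "s' = (u', v', y')" by (metis prod_cases3)
  have "embed s - embed s' = embed (u - u', v - v', y - y')" by (simp add: s embed_def algebra_simps)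
  then show ?thesis using embed_zero[of "u - u'" "v - v'" "y - y'"] assms
    by (auto simp: s points_def)
qed

lemma points_bounds:
  assumes "(u, v, y) \<in> points"
  shows "\<bar>u\<bar> \<le> m" "\<bar>v\<bar> \<le> m" "\<bar>y\<bar> \<le> h"
  using assms by (auto simp: points_def)

text \<open>At \<open>u = 0\<close> the equation would make \<open>g\<close> times a square equal to
  1. A nonzero \<open>u\<close> lets \<open>v\<close> be determined from \<open>u\<close> and
  \<open>y\<close>, and also excludes loops.\<close>

lemma points_u_nonzero: "(u, v, y) \<in> points \<Longrightarrow> u \<noteq> 0"
proof
  assume "(u, v, y) \<in> points" "u = 0"
  then have "p dvd - (g * y\<^sup>2 - 1)" by (simp add: points_def on_quadric_def)
  then show False using no_root by (metis dvd_minus_iff)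
qed

text \<open>For each nonzero \<open>u\<close> and each \<open>y\<close> the equation has exactly one
  solution \<open>v\<close> modulo \<open>p\<close>, with exactly one representative in
  \<open>[-m, m]\<close>.\<close>

lemma card_points: "card points = nat (2 * m * (2 * h + 1))"
proof -
  define f :: "int \<times> int \<times> int \<Rightarrow> int \<times> int" where "f = (\<lambda>(u, v, y). (u, y))"
  have p: "p > 0" using p_eq m_nonneg by simp
  have ndvd: "\<not> p dvd u" if "u \<in> {-m..m} - {0}" for u
  proof
    assume "p dvd u"
    moreover have "\<bar>u\<bar> < p" using that p_eq by auto
    ultimately show False using that dvd_abs_less_imp_zero by blast
  qed
  have "bij_betw f points (({-m..m} - {0}) \<times> {-h..h})"
  proof (rule bij_betw_imageI)
    show "inj_on f points"
    proof (rule inj_onI)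
      fix s s' assume s: "s \<in> points" "s' \<in> points" "f s = f s'"
      obtain u v y v' where e: "s = (u, v, y)" "s' = (u, v', y)"
        using s(3) by (cases s, cases s') (auto simp: f_def)
      have "p dvd (u * v - g * y\<^sup>2 + 1) - (u * v' - g * y\<^sup>2 + 1)"
        using s by (intro dvd_diff) (auto simp: points_def on_quadric_def e)
      also have "(u * v - g * y\<^sup>2 + 1) - (u * v' - g * y\<^sup>2 + 1) = u * (v - v')"
        by (simp add: algebra_simps)
      finally have "p dvd v - v'"
        using ndvd[of u] points_u_nonzero[of u v y] s prime_p
        by (auto simp: e points_def prime_dvd_mult_iff)
      moreover have "\<bar>v - v'\<bar> < p"
        using points_bounds(2)[OF s(1)[unfolded e]] points_bounds(2)[OF s(2)[unfolded e]] p_eq by linarith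
      ultimately have "v - v' = 0" by (rule dvd_abs_less_imp_zero)
      then show "s = s'" by (simp add: e)
    qed
    show "f ` points = ({-m..m} - {0}) \<times> {-h..h}"
    proof (intro equalityI subsetI)
      fix t assume "t \<in> f ` points"
      then show "t \<in> ({-m..m} - {0}) \<times> {-h..h}"
        using points_u_nonzero by (auto simp: f_def points_def)
    next
      fix t assume t: "t \<in> ({-m..m} - {0}) \<times> {-h..h}"
      then obtain u y where uy: "t = (u, y)" "u \<in> {-m..m} - {0}" "y \<in> {-h..h}" by blast
      obtain r where r: "p dvd u * r - 1" using prime_inverse_mod[OF prime_p ndvd[OF uy(2)]] by blast
      define w where "w = r * (g * y\<^sup>2 - 1)"
      define v where "v = (w + m) mod p - m"
      have v: "v \<in> {-m..m}" using p p_eq pos_mod_bound[OF p, of "w + m"] pos_mod_sign[OF p, of "w + m"]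
        by (auto simp: v_def)
      have "w - v = (w + m) - (w + m) mod p" by (simp add: v_def)
      then have "p dvd w - v" by (metis dvd_minus_mod)
      then have "p dvd (g * y\<^sup>2 - 1) * (u * r - 1) - u * (w - v)"
        using r by (meson dvd_diff dvd_mult)
      also have "(g * y\<^sup>2 - 1) * (u * r - 1) - u * (w - v) = u * v - g * y\<^sup>2 + 1"
        by (simp add: w_def algebra_simps)
      finally have "(u, v, y) \<in> points"
        using v uy by (simp add: points_def on_quadric_def)
      then show "t \<in> f ` points" by (force simp: f_def uy)
    qed
  qed
  then have "card points = card (({-m..m} - {0}) \<times> {-h..h})" by (rule bij_betw_same_card)
  also have "\<dots> = nat (2 * m) * nat (2 * h + 1)"
  proof -
    have "card ({-m..m} - {0}) = nat (2 * m)"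
      using m_nonneg by (subst card_Diff_singleton) auto
    then show ?thesis by (simp add: card_cartesian_product)
  qed
  also have "\<dots> = nat (2 * m * (2 * h + 1))"
    using m_nonneg h_nonneg by (simp add: nat_mult_distrib)
  finally show ?thesis .
qed

text \<open>Coordinate differences are at most \<open>2 * m < p\<close> in absolute value, so
  distinct points stay distinct modulo \<open>p\<close>.\<close>

lemma points_differ_mod:
  assumes "(x, y, z) \<in> points" "(x', y', z') \<in> points" "(x, y, z) \<noteq> (x', y', z')"
  shows "\<not> zero_mod p (x' - x, y' - y, z' - z)"
proof
  assume "zero_mod p (x' - x, y' - y, z' - z)"
  then have "p dvd x' - x" "p dvd y' - y" "p dvd z' - z" by (simp_all add: zero_mod_def)
  moreover have "\<bar>x' - x\<bar> < p" "\<bar>y' - y\<bar> < p" "\<bar>z' - z\<bar> < p"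
    using points_bounds[OF assms(1)] points_bounds[OF assms(2)] p_eq h_le by linarith+
  ultimately have "x' - x = 0 \<and> y' - y = 0 \<and> z' - z = 0"
    using dvd_abs_less_imp_zero by blast
  then show False using assms by simp
qed

text \<open>The array entries are shown to satisfy \<open>s i j = s i 0 + s 0 j - s 0 0\<close> as
  vectors, so they form a grid of nine points on the quadric, against
  \<open>no_grid\<close>.\<close>

lemma points_no_grid:
  assumes a: "inj_on a {..<3::nat}" "a ` {..<3} \<subseteq> {..<n}" and b: "inj_on b {..<3::nat}" "b ` {..<3} \<subseteq> {..<n}"
    and ex: "\<forall>i<3. \<forall>j<3. \<exists>d\<in>embed ` points. int n dvd int (a i) - int (b j) - d"
  shows False
proof -
  have "\<forall>i j. \<exists>s. i < 3 \<longrightarrow> j < 3 \<longrightarrow> s \<in> points \<and> int n dvd int (a i) - int (b j) - embed s"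
    using ex by blast
  then obtain s where s: "\<And>i j. i < 3 \<Longrightarrow> j < 3 \<Longrightarrow> s i j \<in> points"
    and ds: "\<And>i j. i < 3 \<Longrightarrow> j < 3 \<Longrightarrow> int n dvd int (a i) - int (b j) - embed (s i j)"
    by metis
  define U V Y where "U i j = fst (s i j)" and "V i j = fst (snd (s i j))" and "Y i j = snd (snd (s i j))" for i j
  have s_eq: "s i j = (U i j, V i j, Y i j)" for i j by (simp add: U_def V_def Y_def)
  have bd: "\<bar>U i j\<bar> \<le> m" "\<bar>V i j\<bar> \<le> m" "\<bar>Y i j\<bar> \<le> h" and on: "on_quadric (U i j) (V i j) (Y i j)"
    if "i < 3" "j < 3" for i j
    using s[OF that] by (auto simp: s_eq points_def)
  have par: "U i j = U i 0 + (U 0 j - U 0 0) \<and> V i j = V i 0 + (V 0 j - V 0 0) \<and> Y i j = Y i 0 + (Y 0 j - Y 0 0)"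
    if "i < 3" "j < 3" for i j
  proof -
    \<comment> \<open>All vertex labels cancel in this alternating sum, leaving a combination of
      four points that \<open>embed_zero\<close> can treat.\<close>
    have "int n dvd (int (a i) - int (b 0) - embed (s i 0)) - (int (a i) - int (b j) - embed (s i j))
       + ((int (a 0) - int (b j) - embed (s 0 j)) - (int (a 0) - int (b 0) - embed (s 0 0)))"
      using that by (intro dvd_add dvd_diff ds) auto
    also have "\<dots> = embed (U i j - U i 0 - U 0 j + U 0 0, V i j - V i 0 - V 0 j + V 0 0, Y i j - Y i 0 - Y 0 j + Y 0 0)"
      by (simp add: s_eq embed_def algebra_simps)
    finally have "U i j - U i 0 - U 0 j + U 0 0 = 0 \<and> V i j - V i 0 - V 0 j + V 0 0 = 0 \<and> Y i j - Y i 0 - Y 0 j + Y 0 0 = 0"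
    proof (rule embed_zero)
      have "i < 3" "j < 3" "(0::nat) < 3" using that by auto
      note b = bd[OF this(1,2)] bd[OF this(1,3)] bd[OF this(3,2)] bd[OF this(3,3)]
      show "\<bar>U i j - U i 0 - U 0 j + U 0 0\<bar> \<le> 4 * m" "\<bar>V i j - V i 0 - V 0 j + V 0 0\<bar> \<le> 4 * m"
        "\<bar>Y i j - Y i 0 - Y 0 j + Y 0 0\<bar> \<le> 4 * h" using b unfolding abs_le_iff by linarith+
    qed
    then show ?thesis by simp
  qed
  have vert: "s i j \<noteq> s i' j" if "i < 3" "i' < 3" "i \<noteq> i'" "j < 3" for i i' j
  proof
    assume e: "s i j = s i' j"
    have "int n dvd (int (a i) - int (b j) - embed (s i j)) - (int (a i') - int (b j) - embed (s i' j))"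
      by (rule dvd_diff[OF ds[OF that(1,4)] ds[OF that(2,4)]])
    then have "int n dvd int (a i) - int (a i')" by (simp add: e)
    moreover have "a i < n" "a i' < n" using a that by auto
    ultimately have "a i = a i'" using dvd_abs_less_imp_zero[of "int n" "int (a i) - int (a i')"] by linarith
    then show False using a that by (auto dest: inj_onD)
  qed
  have horiz: "s i j \<noteq> s i j'" if "j < 3" "j' < 3" "j \<noteq> j'" "i < 3" for i j j'
  proof
    assume e: "s i j = s i j'"
    have "int n dvd (int (a i) - int (b j') - embed (s i j')) - (int (a i) - int (b j) - embed (s i j))"
      by (rule dvd_diff[OF ds[OF that(4,2)] ds[OF that(4,1)]])
    then have "int n dvd int (b j) - int (b j')" by (simp add: e)
    moreover have "b j < n" "b j' < n" using b that by auto
    ultimately have "b j = b j'" using dvd_abs_less_imp_zero[of "int n" "int (b j) - int (b j')"] by linarith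
    then show False using b that by (auto dest: inj_onD)
  qed
  have nzv: "\<not> zero_mod p (U i' 0 - U i 0, V i' 0 - V i 0, Y i' 0 - Y i 0)" if "i < 3" "i' < 3" "i \<noteq> i'" for i i'
    using points_differ_mod s[of i 0] s[of i' 0] vert[OF that, of 0] that by (simp add: s_eq)
  have nzh: "\<not> zero_mod p (U 0 j' - U 0 j, V 0 j' - V 0 j, Y 0 j' - Y 0 j)" if "j < 3" "j' < 3" "j \<noteq> j'" for j j'
    using points_differ_mod s[of 0 j] s[of 0 j'] horiz[OF that, of 0] that by (simp add: s_eq)
  have grid: "on_quadric (U 0 0 + (U i 0 - U 0 0) + (U 0 j - U 0 0)) (V 0 0 + (V i 0 - V 0 0) + (V 0 j - V 0 0))
      (Y 0 0 + (Y i 0 - Y 0 0) + (Y 0 j - Y 0 0))" if "i < 3" "j < 3" for i j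
    using on[OF that] par[OF that] by (simp add: algebra_simps)
  show False
  proof (rule no_grid[of "U 0 0" "V 0 0" "Y 0 0" "U 1 0 - U 0 0" "V 1 0 - V 0 0" "Y 1 0 - Y 0 0"
        "U 2 0 - U 0 0" "V 2 0 - V 0 0" "Y 2 0 - Y 0 0" "U 0 1 - U 0 0" "V 0 1 - V 0 0" "Y 0 1 - Y 0 0"
        "U 0 2 - U 0 0" "V 0 2 - V 0 0" "Y 0 2 - Y 0 0"])
    show "\<not> zero_mod p (U 2 0 - U 0 0 - (U 1 0 - U 0 0), V 2 0 - V 0 0 - (V 1 0 - V 0 0), Y 2 0 - Y 0 0 - (Y 1 0 - Y 0 0))"
      using nzv[of 1 2] by simp
    show "\<not> zero_mod p (U 0 2 - U 0 0 - (U 0 1 - U 0 0), V 0 2 - V 0 0 - (V 0 1 - V 0 0), Y 0 2 - Y 0 0 - (Y 0 1 - Y 0 0))"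
      using nzh[of 1 2] by simp
  qed ((rule grid; simp) | (use on[of 0 0] on[of 1 0] on[of 2 0] on[of 0 1] on[of 0 2] in simp; fail)
      | (use nzv[of 0 1] nzv[of 0 2] nzh[of 0 1] nzh[of 0 2] in simp; fail))+
qed

lemma regular_K33_free_graph:
  defines "G \<equiv> circulant n (embed ` points)"
  shows "pair_graph G" "card (pverts G) = n" "K33_free (with_proj G)"
    "regular_graph (nat (2 * m * (2 * h + 1))) (with_proj G)"
proof -
  have *: "s = s'" if "s \<in> points" "s' \<in> points" "int n dvd embed s - embed s'" for s s'
    using embed_inj that by blast
  have "inj_on embed points" by (rule inj_onI) (simp add: *)
  then have card: "card (embed ` points) = nat (2 * m * (2 * h + 1))" by (simp add: card_image card_points)
  show pg: "pair_graph G"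
    unfolding G_def
  proof (rule circulant_pair_graph)
    fix d assume "d \<in> embed ` points"
    then obtain u v y where d: "(u, v, y) \<in> points" "d = embed (u, v, y)" by auto
    have "(- u, - v, - y) \<in> points" using d by (auto simp: points_def on_quadric_def)
    moreover have "- d = embed (- u, - v, - y)" by (simp add: d embed_def)
    ultimately show "- d \<in> embed ` points" by blast
    show "\<not> int n dvd d"
    proof
      assume "int n dvd d"
      then have "u = 0" using embed_zero[of u v y] d m_nonneg h_nonneg by (auto simp: points_def)
      then show False using points_u_nonzero d by blast
    qed
  qed
  then interpret pair_graph G .
  show "card (pverts G) = n" by (simp add: G_def circulant_def)
  show "K33_free (with_proj G)"
    unfolding G_def using points_no_grid by (intro circulant_K33_free) blast
  have "out_degree (with_proj G) a = card (embed ` points)" if "a < n" for a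
    unfolding G_def
  proof (rule circulant_out_degree)
    fix d d' assume "d \<in> embed ` points" "d' \<in> embed ` points" "int n dvd d - d'"
    then show "d = d'" using * by blast
  qed (rule that)
  moreover have "pverts G = {0..<n}" by (simp add: G_def circulant_def)
  ultimately show "regular_graph (nat (2 * m * (2 * h + 1))) (with_proj G)"
    unfolding regular_graph_def using card graph_axioms by auto
qed

end

lemma exists_regular_K33_free_graph:
  assumes p: "prime (2 * m + 1 :: nat)" and h: "h \<le> m" and n: "(4 * h + 1) * (4 * m + 1)\<^sup>2 \<le> n"
  shows "\<exists>G :: nat pair_pre_digraph. pair_graph G \<and> card (pverts G) = n \<and>
      K33_free (with_proj G) \<and> regular_graph (2 * m * (2 * h + 1)) (with_proj G)"
proof -
  have "prime (int (2 * m + 1))" using p by (simp only: prime_nat_int_transfer)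
  then have "prime (2 * int m + 1)" by (simp add: add.commute)
  then obtain g where "elliptic_quadric (2 * int m + 1) g" using exists_elliptic_quadric[of "2 * int m + 1"] by auto
  then interpret elliptic_quadric "2 * int m + 1" g .
  have "(4 * int h + 1) * (4 * int m + 1)\<^sup>2 = int ((4 * h + 1) * (4 * m + 1)\<^sup>2)"
    unfolding of_nat_mult of_nat_add of_nat_power by simp
  also have "\<dots> \<le> int n" using n by (simp only: of_nat_le_iff)
  finally have "(4 * int h + 1) * (4 * int m + 1)\<^sup>2 \<le> int n" .
  then interpret lifted_quadric "2 * int m + 1" g "int m" "int h" n
    using h by unfold_locales auto
  have "nat (2 * int m * (2 * int h + 1)) = 2 * m * (2 * h + 1)"
    by (simp add: nat_eq_iff algebra_simps)
  then show ?thesis using regular_K33_free_graph by metis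
qed

section \<open>Primes in short intervals\<close>

definition psi :: "nat \<Rightarrow> real" where
  "psi n = (\<Sum>d=1..n. mangoldt d)"

lemma psi_mono: "m \<le> n \<Longrightarrow> psi m \<le> psi n"
  unfolding psi_def by (intro sum_mono2) (auto simp: mangoldt_nonneg)

lemma psi_diff: "m \<le> n \<Longrightarrow> psi n - psi m = (\<Sum>d=m+1..n. mangoldt d)"
proof -
  assume "m \<le> n"
  then have "{1..n} = {1..m} \<union> {m+1..n}" by auto
  then have "psi n = psi m + (\<Sum>d=m+1..n. mangoldt d)"
    unfolding psi_def by (simp add: sum.union_disjoint)
  then show ?thesis by simp
qed

text \<open>Passing from \<open>n\<close> to \<open>Suc n\<close> raises \<open>n div d\<close>
  exactly at the divisors \<open>d\<close> of \<open>Suc n\<close>, whose Mangoldt values add up to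
  its logarithm. The free limit \<open>N\<close> lets several such sums share one range.\<close>

lemma ln_fact_eq_sum_mangoldt:
  "n \<le> N \<Longrightarrow> ln (fact n) = (\<Sum>d=1..N. mangoldt d * real (n div d))"
proof (induction n)
  case (Suc n)
  have "ln (fact (Suc n)) = ln (real (Suc n)) + ln (fact n :: real)"
    by (simp add: ln_mult)
  also have "ln (real (Suc n)) = (\<Sum>d | d dvd Suc n. mangoldt d)"
    using mangoldt_sum[of "Suc n", where ?'a = real] by simp
  also have "\<dots> = (\<Sum>d=1..N. if d dvd Suc n then mangoldt d else 0)"
  proof (rule sum.mono_neutral_cong_left)
    show "{d. d dvd Suc n} \<subseteq> {1..N}"
    proof
      fix d assume "d \<in> {d. d dvd Suc n}"
      then have "d > 0" "d \<le> Suc n" by (auto intro: dvd_pos_nat[of "Suc n"] dvd_imp_le)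
      then show "d \<in> {1..N}" using Suc.prems by simp
    qed
  qed auto
  also have "ln (fact n) = (\<Sum>d=1..N. mangoldt d * real (n div d))"
    using Suc by simp
  also have "(\<Sum>d=1..N. if d dvd Suc n then mangoldt d else 0) + \<dots> =
      (\<Sum>d=1..N. mangoldt d * real (Suc n div d))"
    by (auto simp: sum.distrib[symmetric] div_Suc dvd_eq_mod_eq_0 algebra_simps intro!: sum.cong)
  finally show ?case .
qed auto

text \<open>Chebyshev's factorial ratio with the parameters \<open>6, 1; 3, 2, 2\<close>: it isolates the primes of an
  interval whose end points have a ratio as small as \<open>3/2\<close>.\<close>

definition ln_ratio :: "nat \<Rightarrow> real" where
  "ln_ratio n = ln (fact (6 * n)) + ln (fact n) - ln (fact (3 * n)) - 2 * ln (fact (2 * n))"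

text \<open>The excess of \<open>x + x div 6\<close> over \<open>x div 2 + 2 * (x div 3)\<close> has
  period 6 in \<open>x\<close>, with values 0, 1, 1, 0, 0, 1.\<close>

lemma floor_pattern:
  fixes x :: nat
  shows "x div 2 + 2 * (x div 3) \<le> x + x div 6" "x + x div 6 \<le> x div 2 + 2 * (x div 3) + 1"
    and "1 \<le> x \<Longrightarrow> x \<le> 2 \<Longrightarrow> x + x div 6 = x div 2 + 2 * (x div 3) + 1"
proof -
  define q r where "q = x div 6" and "r = x mod 6"
  have x: "x = r + 6 * q" by (simp add: q_def r_def)
  have "(r + 2 * (3 * q)) div 2 = 3 * q + r div 2" "(r + 3 * (2 * q)) div 3 = 2 * q + r div 3"
    by (rule div_mult_self2; simp)+
  then have d: "x div 2 = 3 * q + r div 2" "x div 3 = 2 * q + r div 3" by (simp_all add: x)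
  have "r < 6" by (simp add: r_def)
  then have "r \<in> {0, 1, 2, 3, 4, 5}" by auto
  then show "x div 2 + 2 * (x div 3) \<le> x + x div 6" "x + x div 6 \<le> x div 2 + 2 * (x div 3) + 1"
    "1 \<le> x \<Longrightarrow> x \<le> 2 \<Longrightarrow> x + x div 6 = x div 2 + 2 * (x div 3) + 1"
    unfolding d q_def[symmetric] by (auto simp: x)
qed

text \<open>The coefficient of \<open>mangoldt d\<close> in \<open>ln_ratio n\<close> is the excess
  of \<open>floor_pattern\<close> at \<open>x = 6 * n div d\<close>, hence 0 or 1. For
  \<open>d\<close> above \<open>2 * n\<close> and up to \<open>6 * n\<close>, this \<open>x\<close>
  is 1 or 2 and the coefficient is 1.\<close>

lemma ln_ratio_bounds:
  shows "psi (6 * n) - psi (2 * n) \<le> ln_ratio n" "ln_ratio n \<le> psi (6 * n)" "0 \<le> ln_ratio n"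
proof -
  define c where "c d = real (6 * n div d) + real (n div d) - real (3 * n div d) - 2 * real (2 * n div d)" for d
  have eq: "ln_ratio n = (\<Sum>d=1..6*n. mangoldt d * c d)"
    using ln_fact_eq_sum_mangoldt[of "6 * n" "6 * n"] ln_fact_eq_sum_mangoldt[of n "6 * n"]
      ln_fact_eq_sum_mangoldt[of "3 * n" "6 * n"] ln_fact_eq_sum_mangoldt[of "2 * n" "6 * n"]
    by (simp add: ln_ratio_def c_def algebra_simps sum.distrib sum_subtractf sum_distrib_left)
  have c: "c d = real (x + x div 6) - real (x div 2 + 2 * (x div 3))" if "x = 6 * n div d" for d x
  proof -
    have "n div d = x div 6" "3 * n div d = x div 2" "2 * n div d = x div 3"
      unfolding that by (simp_all add: div_mult2_eq[symmetric] mult.commute[of d])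
    then show ?thesis using that by (simp add: c_def)
  qed
  have c01: "0 \<le> c d" "c d \<le> 1" for d
    using floor_pattern(1,2)[of "6 * n div d"] unfolding c[OF refl] by linarith+
  have c1: "c d = 1" if "d \<in> {2*n+1..6*n}" for d
  proof -
    have "6 * n div d < 3" using that by (simp add: div_less_iff_less_mult)
    then have "6 * n div d \<le> 2" by simp
    moreover have "1 \<le> 6 * n div d" using that by (auto simp: Suc_le_eq div_greater_zero_iff)
    ultimately show ?thesis using floor_pattern(3)[of "6 * n div d"] unfolding c[OF refl] by linarith
  qed
  have "psi (6 * n) - psi (2 * n) = (\<Sum>d=2*n+1..6*n. mangoldt d * c d)"
    using psi_diff[of "2 * n" "6 * n"] by (simp add: c1)
  also have "\<dots> \<le> ln_ratio n"
    unfolding eq by (intro sum_mono2) (auto intro!: mult_nonneg_nonneg mangoldt_nonneg c01)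
  finally show "psi (6 * n) - psi (2 * n) \<le> ln_ratio n" .
  show "ln_ratio n \<le> psi (6 * n)"
    unfolding eq psi_def by (intro sum_mono mult_left_le mangoldt_nonneg c01)
  show "0 \<le> ln_ratio n"
    unfolding eq by (intro sum_nonneg mult_nonneg_nonneg mangoldt_nonneg c01)
qed

text \<open>After cancellation the factorial ratio grows by a factor that tends to
  \<open>108 = 6^6 / (3^3 * 2^4)\<close>, the source of \<open>ln 108\<close> below.\<close>

lemma ln_ratio_Suc:
  "ln_ratio (Suc n) = ln_ratio n
     + ln (6 * (6 * real n + 1) * (6 * real n + 5) / ((2 * real n + 1) * (real n + 1)))"
proof -
  have f: "ln (fact (Suc k) :: real) = ln (real k + 1) + ln (fact k)" for k
    by (simp add: ln_mult add.commute)
  have "6 * Suc n = Suc (Suc (Suc (Suc (Suc (Suc (6 * n))))))" "3 * Suc n = Suc (Suc (Suc (3 * n)))"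
    "2 * Suc n = Suc (Suc (2 * n))" by simp_all
  then have 1: "ln_ratio (Suc n) = ln_ratio n
      + (ln (6 * real n + 1) + ln (6 * real n + 2) + ln (6 * real n + 3) + ln (6 * real n + 4)
         + ln (6 * real n + 5) + ln (6 * real n + 6)) + ln (real n + 1)
      - (ln (3 * real n + 1) + ln (3 * real n + 2) + ln (3 * real n + 3))
      - 2 * (ln (2 * real n + 1) + ln (2 * real n + 2))"
    by (simp only: ln_ratio_def f) (simp add: algebra_simps)
  have "6 * real n + 2 = 2 * (3 * real n + 1)" "6 * real n + 4 = 2 * (3 * real n + 2)"
    "6 * real n + 3 = 3 * (2 * real n + 1)" "6 * real n + 6 = 6 * (real n + 1)"
    "3 * real n + 3 = 3 * (real n + 1)" "2 * real n + 2 = 2 * (real n + 1)" by simp_all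
  then have 2: "ln (6 * real n + 2) = ln 2 + ln (3 * real n + 1)" "ln (6 * real n + 4) = ln 2 + ln (3 * real n + 2)"
    "ln (6 * real n + 3) = ln 3 + ln (2 * real n + 1)" "ln (6 * real n + 6) = ln 6 + ln (real n + 1)"
    "ln (3 * real n + 3) = ln 3 + ln (real n + 1)" "ln (2 * real n + 2) = ln 2 + ln (real n + 1)"
    using ln_mult_pos[of 2 "3 * real n + 1"] ln_mult_pos[of 2 "3 * real n + 2"] ln_mult_pos[of 3 "2 * real n + 1"]
      ln_mult_pos[of 6 "real n + 1"] ln_mult_pos[of 3 "real n + 1"] ln_mult_pos[of 2 "real n + 1"] by simp_all
  have pos: "6 * real n + 1 > 0" "6 * real n + 5 > 0" "2 * real n + 1 > 0" "real n + 1 > 0" by simp_all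
  have 3: "ln (6 * (6 * real n + 1) * (6 * real n + 5) / ((2 * real n + 1) * (real n + 1)))
     = ln 6 + ln (6 * real n + 1) + ln (6 * real n + 5) - (ln (2 * real n + 1) + ln (real n + 1))"
    using pos ln_divide_pos[of "6 * (6 * real n + 1) * (6 * real n + 5)" "(2 * real n + 1) * (real n + 1)"]
      ln_mult_pos[of "6 * (6 * real n + 1)" "6 * real n + 5"] ln_mult_pos[of 6 "6 * real n + 1"]
      ln_mult_pos[of "2 * real n + 1" "real n + 1"] by (simp only: mult_pos_pos zero_less_numeral)
  show ?thesis unfolding 1 2 3 by simp
qed

lemma ln_ratio_upper: "ln_ratio n \<le> real n * ln 108"
proof (induction n)
  case (Suc n)
  have "6 * (6 * real n + 1) * (6 * real n + 5) / ((2 * real n + 1) * (real n + 1)) \<le> 108"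
    by (subst pos_divide_le_eq) (simp, simp add: algebra_simps)
  then have "ln (6 * (6 * real n + 1) * (6 * real n + 5) / ((2 * real n + 1) * (real n + 1))) \<le> ln 108"
    by (subst ln_le_cancel_iff) auto
  then show ?case using Suc by (simp add: ln_ratio_Suc algebra_simps)
qed (simp add: ln_ratio_def)

text \<open>Each step gains at least \<open>ln (108 * n / (n + 1))\<close>, and the corrections
  telescope to \<open>- ln n\<close>.\<close>

lemma ln_ratio_lower: "n > 0 \<Longrightarrow> (real n - 1) * ln 108 - ln (real n) \<le> ln_ratio n"
proof (induction n rule: nat_induct_non_zero)
  case 1
  then show ?case using ln_ratio_bounds(3) by simp
next
  case (Suc n)
  have "108 * real n / (real n + 1) \<le> 6 * (6 * real n + 1) * (6 * real n + 5) / ((2 * real n + 1) * (real n + 1))"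
  proof -
    have "108 * real n * ((2 * real n + 1) * (real n + 1)) \<le> 6 * (6 * real n + 1) * (6 * real n + 5) * (real n + 1)"
      by (simp add: algebra_simps)
    then show ?thesis by (simp add: pos_divide_le_eq pos_le_divide_eq)
  qed
  then have "ln (108 * real n / (real n + 1)) \<le> ln (6 * (6 * real n + 1) * (6 * real n + 5) / ((2 * real n + 1) * (real n + 1)))"
    using Suc.hyps by (subst ln_le_cancel_iff) auto
  moreover have "ln (108 * real n / (real n + 1)) = ln 108 + ln (real n) - ln (real n + 1)"
    using Suc.hyps by (simp add: ln_div ln_mult_pos)
  ultimately show ?case using Suc.IH by (simp add: ln_ratio_Suc algebra_simps)
qed

text \<open>Iterating the bound \<open>k * ln 108\<close> for
  \<open>psi (6 * k) - psi (2 * k)\<close> gives the geometric series 1/6 + 1/18 + ... = 1/4. The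
  slightly larger 63/250 pays for rounding up to multiples of six once \<open>n > 1200\<close>;
  \<open>psi 1200\<close> covers smaller \<open>n\<close>.\<close>

lemma psi_upper: "psi n \<le> 63 / 250 * ln 108 * real n + psi 1200"
proof (induction n rule: less_induct)
  case (less n)
  have pos: "(ln 108 :: real) > 0" by simp
  show ?case
  proof (cases "n \<le> 1200")
    case True
    have "psi n \<le> psi 1200" by (rule psi_mono[OF True])
    moreover have "0 \<le> 63 / 250 * ln 108 * real n" using pos by (intro mult_nonneg_nonneg) auto
    ultimately show ?thesis by linarith
  next
    case False
    define k where "k = n div 6 + 1"
    have k: "n \<le> 6 * k" "2 * k < n" "6 * real k \<le> real n + 6" using False by (auto simp: k_def)
    have "psi n \<le> psi (6 * k)" using k by (intro psi_mono)
    also have "\<dots> \<le> psi (2 * k) + real k * ln 108"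
      using ln_ratio_bounds(1)[of k] ln_ratio_upper[of k] by linarith
    also have "\<dots> \<le> (63 / 250 * ln 108 * real (2 * k) + psi 1200) + real k * ln 108"
      using less[OF k(2)] by simp
    also have "\<dots> = ln 108 * (376 / 250 * real k) + psi 1200" by (simp add: algebra_simps)
    also have "\<dots> \<le> ln 108 * (63 / 250 * real n) + psi 1200"
      using k(3) False by (intro add_mono mult_left_mono) auto
    finally show ?thesis by (simp add: algebra_simps)
  qed
qed

text \<open>Of the loss \<open>2 * ln 108\<close>, one half comes from rounding \<open>n\<close>
  down to a multiple of six, the other from \<open>ln_ratio_lower\<close>.\<close>

lemma psi_lower: "n \<ge> 6 \<Longrightarrow> (real n / 6 - 2) * ln 108 - ln (real n) \<le> psi n"
proof -
  assume n: "n \<ge> 6"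
  define k where "k = n div 6"
  have k: "k > 0" "6 * k \<le> n" "real n \<le> 6 * real k + 6" using n by (auto simp: k_def)
  have "(real n / 6 - 2) * ln 108 \<le> (real k - 1) * ln 108" using k by (intro mult_right_mono) auto
  moreover have "ln (real k) \<le> ln (real n)" using k by simp
  moreover have "ln_ratio k \<le> psi n" using ln_ratio_bounds(2)[of k] psi_mono[OF k(2)] by linarith
  ultimately show ?thesis using ln_ratio_lower[OF k(1)] by linarith
qed

section \<open>From \<open>psi\<close> to primes\<close>

lemma ln_two_ge_half: "1 / 2 \<le> ln (2 :: real)"
proof -
  have "(1::real) \<le> ln 4" using exp_le by (subst ln_ge_iff) auto
  also have "ln 4 = 2 * ln (2::real)" using ln_realpow[of 2 2] by simp
  finally show ?thesis by simp
qed

text \<open>Such a number is \<open>q ^ k\<close> with \<open>k \<ge> 2\<close>, so \<open>q\<close>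
  is at most the square root of \<open>n\<close>, and \<open>2 ^ k \<le> n\<close> gives
  \<open>k \<le> 2 * ln n\<close>; the pairs are counted.\<close>

lemma card_proper_primepows:
  assumes n: "n > 0"
  shows "real (card {d\<in>{1..n}. primepow d \<and> \<not> prime d}) \<le> (sqrt (real n) + 1) * (2 * ln (real n) + 1)"
proof -
  define s t where "s = nat \<lfloor>sqrt (real n)\<rfloor>" and "t = nat \<lfloor>2 * ln (real n)\<rfloor>"
  have "{d\<in>{1..n}. primepow d \<and> \<not> prime d} \<subseteq> (\<lambda>(q, k). q ^ k) ` ({0..s} \<times> {0..t})"
  proof
    fix d assume d: "d \<in> {d\<in>{1..n}. primepow d \<and> \<not> prime d}"
    then obtain q k where q: "prime q" "k > 0" "d = q ^ k" by (auto simp: primepow_def)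
    have q2: "q \<ge> 2" using q prime_ge_2_nat by blast
    have k2: "k \<ge> 2" using q d by (cases "k = 1") auto
    have "q ^ 2 \<le> q ^ k" using q2 k2 by (intro power_increasing) auto
    then have "q ^ 2 \<le> n" using d q by simp
    then have "(real q)\<^sup>2 \<le> real n" by (simp flip: of_nat_power)
    then have "real q \<le> sqrt (real n)" by (rule real_le_rsqrt)
    then have 1: "q \<le> s" unfolding s_def by linarith
    have "2 ^ k \<le> q ^ k" using q2 by (intro power_mono) auto
    moreover have "q ^ k \<le> n" using d q by simp
    ultimately have "2 ^ k \<le> n" by (rule order_trans)
    then have "(2::real) ^ k \<le> real n" by (metis of_nat_le_iff of_nat_numeral of_nat_power)
    then have "real k * ln 2 \<le> ln (real n)"
      using n by (metis ln_le_cancel_iff ln_realpow of_nat_0_less_iff zero_less_numeral zero_less_power)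
    moreover have "real k * (1 / 2) \<le> real k * ln 2"
      using ln_two_ge_half by (intro mult_left_mono) auto
    ultimately have 2: "k \<le> t" unfolding t_def by linarith
    show "d \<in> (\<lambda>(q, k). q ^ k) ` ({0..s} \<times> {0..t})" 
      using 1 2 q by (intro image_eqI[of _ _ "(q, k)"]) auto
  qed
  then have "card {d\<in>{1..n}. primepow d \<and> \<not> prime d} \<le> card ({0..s} \<times> {0..t})"
    by (intro surj_card_le) simp
  also have "\<dots> = (s + 1) * (t + 1)" by (simp add: card_cartesian_product)
  finally have "real (card {d\<in>{1..n}. primepow d \<and> \<not> prime d}) \<le> real ((s + 1) * (t + 1))"
    by (simp only: of_nat_le_iff)
  also have "\<dots> = (real s + 1) * (real t + 1)" by (simp add: algebra_simps)
  also have "\<dots> \<le> (sqrt (real n) + 1) * (2 * ln (real n) + 1)"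
    using n by (intro mult_mono) (auto simp: s_def t_def)
  finally show ?thesis .
qed

text \<open>Without primes between \<open>a\<close> and \<open>b\<close> only proper prime powers
  contribute, each at most \<open>ln b\<close>, so the difference is of lower than linear
  order.\<close>

lemma psi_diff_le_if_no_primes:
  assumes "a \<le> b" "b > 0" and no: "\<And>q. prime q \<Longrightarrow> a < q \<Longrightarrow> b < q"
  shows "psi b - psi a \<le> (sqrt (real b) + 1) * (2 * ln (real b) + 1) * ln (real b)"
proof -
  let ?P = "{d\<in>{1..b}. primepow d \<and> \<not> prime d}"
  have "psi b - psi a = (\<Sum>d=a+1..b. mangoldt d)" by (rule psi_diff[OF assms(1)])
  also have "\<dots> = (\<Sum>d\<in>?P \<inter> {a+1..b}. mangoldt d)"
  proof (rule sum.mono_neutral_right)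
    show "\<forall>d\<in>{a+1..b} - ?P \<inter> {a+1..b}. mangoldt d = (0 :: real)"
    proof
      fix d assume "d \<in> {a+1..b} - ?P \<inter> {a+1..b}"
      then have "a < d" "d \<le> b" "\<not> (primepow d \<and> \<not> prime d)" by auto
      then have "\<not> primepow d" using no[of d] leD by blast
      then show "mangoldt d = (0 :: real)" by (simp add: mangoldt_def)
    qed
  qed auto
  also have "\<dots> \<le> (\<Sum>d\<in>?P. mangoldt d)"
    by (intro sum_mono2) (auto simp: mangoldt_nonneg)
  also have "\<dots> \<le> (\<Sum>d\<in>?P. ln (real b))"
  proof (rule sum_mono)
    fix d assume d: "d \<in> ?P"
    then have "mangoldt d \<le> ln (real d)" using mangoldt_le[of d] by auto
    also have "\<dots> \<le> ln (real b)" using d by auto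
    finally show "mangoldt d \<le> ln (real b)" .
  qed
  also have "\<dots> = real (card ?P) * ln (real b)" by simp
  also have "\<dots> \<le> (sqrt (real b) + 1) * (2 * ln (real b) + 1) * ln (real b)"
    using assms by (intro mult_right_mono card_proper_primepows) auto
  finally show ?thesis .
qed

text \<open>In units of \<open>ln 108\<close>, \<open>psi\<close> at \<open>79 / 50 * x\<close> is
  at least about \<open>79 / 300 * x\<close>, and at \<open>x\<close> at most about
  \<open>63 / 250 * x\<close>. As 79/300 > 63/250, the difference is linear in \<open>x\<close>, too
  large for an interval without primes.\<close>

lemma eventually_prime_between:
  "\<forall>\<^sub>F x :: real in at_top. \<exists>p :: nat. prime p \<and> x < real p \<and> real p \<le> 79 / 50 * x"
proof -
  define D where "D = psi 1200"
  define K :: real where "K = ln 108"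
  have K: "K > 0" by (simp add: K_def)
  have "\<forall>\<^sub>F x :: real in at_top. K * ((79 / 50 * x - 1) / 6 - 2) - ln (79 / 50 * x)
      - (63 / 250 * K * x + D) > (sqrt (79 / 50 * x) + 1) * (2 * ln (79 / 50 * x) + 1) * ln (79 / 50 * x)"
    using K by real_asymp
  then show ?thesis
    using eventually_ge_at_top[of 10]
  proof eventually_elim
    case (elim x)
    define a b where "a = nat \<lfloor>x\<rfloor>" and "b = nat \<lfloor>79 / 50 * x\<rfloor>"
    have ab: "a \<le> b" "b \<ge> 6" "real a \<le> x" "79 / 50 * x - 1 \<le> real b" "real b \<le> 79 / 50 * x"
      using elim(2) unfolding a_def b_def by linarith+
    show ?case
    proof (rule ccontr)
      assume none: "\<not> (\<exists>p :: nat. prime p \<and> x < real p \<and> real p \<le> 79 / 50 * x)"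
      have "psi b - psi a \<le> (sqrt (real b) + 1) * (2 * ln (real b) + 1) * ln (real b)"
      proof (rule psi_diff_le_if_no_primes)
        fix q :: nat assume q: "prime q" "a < q"
        then have "x < real q" using elim(2) unfolding a_def by linarith
        then have "79 / 50 * x < real q" using none q(1) not_le by blast
        then show "b < q" using ab by linarith
      qed (use ab in auto)
      also have "\<dots> \<le> (sqrt (79 / 50 * x) + 1) * (2 * ln (79 / 50 * x) + 1) * ln (79 / 50 * x)"
        using ab by (intro mult_mono add_mono) auto
      finally have up: "psi b - psi a \<le> \<dots>" .
      have "K * ((79 / 50 * x - 1) / 6 - 2) \<le> (real b / 6 - 2) * K"
        using ab K by (subst mult.commute, intro mult_right_mono) auto
      moreover have "ln (real b) \<le> ln (79 / 50 * x)" using ab by simp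
      moreover have "63 / 250 * K * real a \<le> 63 / 250 * K * x" using ab K by (intro mult_left_mono) auto
      ultimately show False
        using psi_lower[OF ab(2)] psi_upper[of a] up elim(1) unfolding K_def[symmetric] D_def[symmetric] by linarith
    qed
  qed
qed

section \<open>Choice of the parameters\<close>

text \<open>In the application \<open>p\<close> is the chosen prime, \<open>n = 13 * x ^ 3\<close> and \<open>2 * h + 1\<close> is the length of the
  interval of the third coordinate, which is limited either by \<open>p\<close> itself or by \<open>n\<close>.\<close>

lemma degree_bound:
  fixes x p h :: real
  assumes p: "101 / 100 * x < p" "p \<le> 8 / 5 * x"
    and x: "1000 \<le> x"
    and h: "2 * h + 1 = p \<or> 13 * x ^ 3 < (4 * h + 5) * (2 * p - 1)\<^sup>2"
  shows "x\<^sup>2 \<le> (p - 1) * (2 * h + 1)"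
  using h
proof
  assume "2 * h + 1 = p"
  \<comment> \<open>The margin \<open>x / 100\<close> is at least 10, so \<open>p - 1\<close> still
    exceeds \<open>x\<close>.\<close>
  have "x * x \<le> (p - 1) * p" using p x by (intro mult_mono) auto
  then show ?thesis using \<open>2 * h + 1 = p\<close> by (simp add: power2_eq_square)
next
  assume *: "13 * x ^ 3 < (4 * h + 5) * (2 * p - 1)\<^sup>2"
  have pos: "p > 0" "x > 0" using p x by linarith+
  have "4 * h + 5 > 0"
    using * pos by (smt (verit) mult_nonpos_nonneg zero_le_power2 zero_less_power)
  then have "(4 * h + 5) * (2 * p - 1)\<^sup>2 \<le> (4 * h + 5) * (2 * p)\<^sup>2"
    using p x by (intro mult_left_mono power_mono) auto
  then have "13 * x ^ 3 \<le> (4 * h + 5) * (4 * p\<^sup>2)" using * by simp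
  also have "\<dots> \<le> ((4 * h + 5) * (4 * p)) * (8 / 5 * x)"
    using p pos \<open>4 * h + 5 > 0\<close> by (simp add: power2_eq_square mult.assoc)
  finally have "x * (13 * x\<^sup>2) \<le> x * ((4 * h + 5) * (4 * p) * (8 / 5))"
    by (simp add: power2_eq_square power3_eq_cube mult_ac)
  then have "13 * x\<^sup>2 \<le> (4 * h + 5) * (4 * p) * (8 / 5)" using pos by simp
  \<comment> \<open>The surplus \<open>x\<^sup>2 / 64\<close>, due to 13/8 > 8/5, has to absorb the
    terms linear in \<open>x\<close> that are lost in passing to
    \<open>(p - 1) * (2 * h + 1)\<close>.\<close>
  then have 1: "65 / 64 * x\<^sup>2 \<le> p * (2 * h + 5 / 2)" by (simp add: algebra_simps)
  show ?thesis
  proof (rule ccontr)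
    assume "\<not> ?thesis"
    then have 2: "(p - 1) * (2 * h + 1) < x\<^sup>2" by simp
    have "2 * h + 1 < 2 * x"
    proof (rule ccontr)
      assume "\<not> ?thesis"
      then have "x * x \<le> (p - 1) * (2 * h + 1)" using p x by (intro mult_mono) auto
      then show False using 2 by (simp add: power2_eq_square)
    qed
    moreover have "p * (2 * h + 5 / 2) = (p - 1) * (2 * h + 1) + (2 * h + 1) + 3 / 2 * p"
      by (simp add: algebra_simps)
    ultimately have "1 / 64 * x\<^sup>2 < 22 / 5 * x" using 1 2 p by linarith
    then have "x * x < x * (64 * 22 / 5)" by (simp add: power2_eq_square)
    then show False using x by simp
  qed
qed

lemma exists_dense_regular_K33_free_graph:
  fixes n p :: nat and x :: real
  assumes n: "13 * x ^ 3 = real n" and p: "prime p" "101 / 100 * x < real p" "real p \<le> 8 / 5 * x"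
    and x: "1000 \<le> x"
  shows "\<exists>(G :: nat pair_pre_digraph) k. pair_graph G \<and> card (pverts G) = n \<and>
      K33_free (with_proj G) \<and> regular_graph k (with_proj G) \<and> x\<^sup>2 \<le> real k"
proof -
  have "p > 2" using p x by linarith
  then have "odd p" using p(1) prime_odd_nat by blast
  then obtain m where m: "p = 2 * m + 1" by (metis oddE)
  define q where "q = n div (4 * m + 1)\<^sup>2"
  \<comment> \<open>The largest \<open>h \<le> m\<close> with \<open>4 * h + 1 \<le> q\<close>; the
    bound \<open>q \<ge> 1\<close> shown below keeps the truncated \<open>q - 1\<close>
    harmless.\<close>
  define h where "h = min m ((q - 1) div 4)"
  have r: "real (4 * m + 1) = 2 * real p - 1" by (simp add: m)
  have "(2 * real p - 1)\<^sup>2 \<le> (16 / 5 * x)\<^sup>2" using p \<open>p > 2\<close> by (intro power_mono) auto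
  also have "\<dots> \<le> 13 * x ^ 3" using x by (simp add: power2_eq_square power3_eq_cube)
  finally have "real ((4 * m + 1)\<^sup>2) \<le> real n" by (simp only: n r of_nat_power)
  then have "(4 * m + 1)\<^sup>2 \<le> n" by (simp only: of_nat_le_iff)
  then have q: "q \<ge> 1" by (simp add: q_def Suc_le_eq div_greater_zero_iff)
  have "4 * h + 1 \<le> q" using q by (auto simp: h_def min_def)
  then have "(4 * h + 1) * (4 * m + 1)\<^sup>2 \<le> q * (4 * m + 1)\<^sup>2" by (rule mult_le_mono1)
  also have "\<dots> \<le> n" by (simp add: q_def)
  finally have "\<exists>G :: nat pair_pre_digraph. pair_graph G \<and> card (pverts G) = n \<and>
      K33_free (with_proj G) \<and> regular_graph (2 * m * (2 * h + 1)) (with_proj G)"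
    using p(1) by (intro exists_regular_K33_free_graph) (simp_all add: m h_def)
  moreover have "x\<^sup>2 \<le> real (2 * m * (2 * h + 1))"
  proof -
    have "2 * real h + 1 = real p \<or> 13 * x ^ 3 < (4 * real h + 5) * (2 * real p - 1)\<^sup>2"
    proof (cases "h = m")
      \<comment> \<open>Here \<open>h = (q - 1) div 4\<close>, so \<open>q \<le> 4 * h + 4\<close>:
        the size of \<open>n\<close> is what limits \<open>h\<close>.\<close>
      case False
      then have "q + 1 \<le> 4 * h + 5" using q by (auto simp: h_def min_def split: if_splits)
      have "n < (q + 1) * (4 * m + 1)\<^sup>2"
        unfolding q_def by (metis dividend_less_div_times mult.commute Suc_eq_plus1 add.commute mult_Suc zero_less_Suc
          zero_less_power add_gr_0 zero_less_one)
      also have "\<dots> \<le> (4 * h + 5) * (4 * m + 1)\<^sup>2"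
        using \<open>q + 1 \<le> 4 * h + 5\<close> by (rule mult_le_mono1)
      finally have "real n < real ((4 * h + 5) * (4 * m + 1)\<^sup>2)" by (simp only: of_nat_less_iff)
      also have "\<dots> = (4 * real h + 5) * (2 * real p - 1)\<^sup>2"
        by (simp only: of_nat_mult of_nat_power r) simp
      finally show ?thesis using n by simp
    qed (simp add: m)
    then have "x\<^sup>2 \<le> (real p - 1) * (2 * real h + 1)" by (rule degree_bound[OF p(2,3) x])
    then show ?thesis by (simp add: m algebra_simps)
  qed
  ultimately show ?thesis by blast
qed

theorem theorem5p1:
  fixes \<epsilon> :: real
  assumes "\<epsilon> > 0"
  shows "\<exists>C::real. \<forall>\<^sub>F n::nat in sequentially.
    \<exists>(G :: nat pair_pre_digraph) k::nat.
      pair_graph G \<and> card (pverts G) = n \<and>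
      K33_free (with_proj G) \<and> regular_graph k (with_proj G) \<and>
      (odd n \<longrightarrow> real k \<ge> (real n / 13) powr (2/3) - C * real n powr (3/5 + \<epsilon>)) \<and>
      (even n \<longrightarrow> real k \<ge> (real n / 14) powr (2/3) - C * real n powr (3/5 + \<epsilon>))"
proof (intro exI[of _ 0])
  \<comment> \<open>Normalised so that \<open>n = 13 * X n ^ 3\<close>; the required degree is then
    the square of \<open>X n\<close>.\<close>
  define X where "X n = (real n / 13) powr (1/3)" for n :: nat
  have "filterlim (\<lambda>n. 101 / 100 * X n) at_top sequentially"
    unfolding X_def by real_asymp
  \<comment> \<open>The product of 79/50 and 101/100 is 1.5958, which stays below 8/5.\<close>
  then have "\<forall>\<^sub>F n in sequentially. \<exists>p::nat. prime p \<and> 101 / 100 * X n < real p \<and>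
      real p \<le> 79 / 50 * (101 / 100 * X n)"
    by (rule eventually_compose_filterlim[OF eventually_prime_between])
  moreover have "\<forall>\<^sub>F n in sequentially. 1000 \<le> X n"
    unfolding X_def by real_asymp
  ultimately show "\<forall>\<^sub>F n::nat in sequentially.
    \<exists>(G :: nat pair_pre_digraph) k::nat.
      pair_graph G \<and> card (pverts G) = n \<and>
      K33_free (with_proj G) \<and> regular_graph k (with_proj G) \<and>
      (odd n \<longrightarrow> real k \<ge> (real n / 13) powr (2/3) - 0 * real n powr (3/5 + \<epsilon>)) \<and>
      (even n \<longrightarrow> real k \<ge> (real n / 14) powr (2/3) - 0 * real n powr (3/5 + \<epsilon>))"
  proof eventually_elim
    case (elim n)
    then obtain p :: nat where p: "prime p" "101 / 100 * X n < real p" "real p \<le> 79 / 50 * (101 / 100 * X n)"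
      by blast
    have n: "n > 0" using elim(2) by (intro Nat.gr0I) (auto simp: X_def)
    have "13 * X n ^ 3 = real n" using n by (simp add: X_def powr_power)
    moreover have "real p \<le> 8 / 5 * X n" using p(3) elim(2) by simp
    ultimately obtain G :: "nat pair_pre_digraph" and k where
      G: "pair_graph G" "card (pverts G) = n" "K33_free (with_proj G)" "regular_graph k (with_proj G)"
      and k: "(X n)\<^sup>2 \<le> real k"
      using exists_dense_regular_K33_free_graph[OF _ p(1,2) _ elim(2)] by blast
    have "(X n)\<^sup>2 = (real n / 13) powr (2/3)" using n by (simp add: X_def powr_power)
    then have "(real n / 13) powr (2/3) \<le> real k" using k by simp
    \<comment> \<open>The degree \<open>2 * m * (2 * h + 1)\<close> is even, so both parities of
      \<open>n\<close> share one construction, and the bound for odd \<open>n\<close> implies the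
      one for even \<open>n\<close>.\<close>
    moreover have "(real n / 14) powr (2/3) \<le> (real n / 13) powr (2/3)"
      by (intro powr_mono2) auto
    ultimately show ?case using G by (intro exI[of _ G] exI[of _ k]) simp
  qed
qed

end
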